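(* Let $D$ be the formal derivative with respect to the context-free grammar $x \rightarrow xy,\ y \rightarrow x^2$. For every integer $n\geq 1$, \[ D^n(x)=\sum_{k=0}^{\lfloor n/2\rfloor} T(n,k)\, x^{2k+1}y^{n-2k}, \] where $T(n,k)$ is the number of permutations of $[n]$ with exactly $k$ exterior peaks.
   Context: The formal derivative $D$ with respect to a grammar is the unique linear operator on polynomials in the letters that sends each letter to its image under the grammar's rule and satisfies the Leibniz rule $D(uv)=D(u)v+uD(v)$. For a permutation $\pi=\pi_1\pi_2\cdots\pi_n$ of $[n]$, an index $i$ is an exterior peak if either $1<i<n$ and $\pi_{i-1}<\pi_i>\pi_{i+1}$, or $i=1$ (with $n\geq 2$) and $\pi_1>\pi_2$. (The index $i=n$ is never an exterior peak.) *)

theory Defs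
  imports
    Complex_Main
    "HOL-Library.Poly_Mapping"
    "HOL-Combinatorics.Permutations"
begin

text \<open>
  Commutative polynomials with coefficients in \<open>'a\<close> in the letters \<open>'v\<close>: finitely supported maps
  from monomials (exponent vectors) to coefficients, with the convolution product.
\<close>

type_synonym ('v, 'a) letter_poly = "('v \<Rightarrow>\<^sub>0 nat) \<Rightarrow>\<^sub>0 'a"

definition Letter :: "'v \<Rightarrow> ('v, 'a::comm_ring_1) letter_poly"
  where "Letter v = Poly_Mapping.single (Poly_Mapping.single v 1) 1"

definition Scalar :: "'a::comm_ring_1 \<Rightarrow> ('v, 'a) letter_poly"
  where "Scalar c = Poly_Mapping.single 0 c"

text \<open>A grammar assigns to each letter the polynomial it is rewritten to.\<close>

definition is_formal_derivative ::
  "('v \<Rightarrow> ('v, 'a::comm_ring_1) letter_poly) \<Rightarrow>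
   (('v, 'a) letter_poly \<Rightarrow> ('v, 'a) letter_poly) \<Rightarrow> bool"
  where "is_formal_derivative G D \<longleftrightarrow>
    (\<forall>u v. D (u + v) = D u + D v) \<and>
    (\<forall>c u. D (Scalar c * u) = Scalar c * D u) \<and>
    (\<forall>u v. D (u * v) = D u * v + u * D v) \<and>
    (\<forall>a. D (Letter a) = G a)"

definition formal_derivative ::
  "('v \<Rightarrow> ('v, 'a::comm_ring_1) letter_poly) \<Rightarrow>
   ('v, 'a) letter_poly \<Rightarrow> ('v, 'a) letter_poly"
  where "formal_derivative G = (THE D. is_formal_derivative G D)"

datatype letter = X | Y

fun grammar :: "letter \<Rightarrow> (letter, 'a::comm_ring_1) letter_poly"
  where
    "grammar X = Letter X * Letter Y"
  | "grammar Y = (Letter X)\<^sup>2"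

text \<open>\<open>p\<close> is read as the word \<open>p 1, \<dots>, p n\<close>.\<close>

definition exterior_peak :: "nat \<Rightarrow> (nat \<Rightarrow> nat) \<Rightarrow> nat \<Rightarrow> bool"
  where "exterior_peak n p i \<longleftrightarrow>
    (1 < i \<and> i < n \<and> p (i - 1) < p i \<and> p i > p (i + 1)) \<or>
    (i = 1 \<and> n \<ge> 2 \<and> p 1 > p 2)"

definition T :: "nat \<Rightarrow> nat \<Rightarrow> nat"
  where "T n k = card {p. p permutes {1..n} \<and> card {i. exterior_peak n p i} = k}"


text \<open>The description by \<open>THE\<close> is well defined: the formal derivative exists and is unique.\<close>

lemma letter_poly_induct:
  fixes p :: "('v, 'a::comm_ring_1) letter_poly"
  assumes zero: "P 0"
    and add: "\<And>m c q. P q \<Longrightarrow> P (Poly_Mapping.single m c + q)"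
  shows "P p"
proof (induction p rule: update_induct)
  case const
  show ?case by (rule zero)
next
  case (update f a b)
  have "Poly_Mapping.update a b f = Poly_Mapping.single a b + f"
    using update(1)
    by (intro poly_mapping_eqI)
      (auto simp: lookup_update lookup_add lookup_single in_keys_iff when_def)
  with add[OF update(3)] show ?case by simp
qed

definition monom_deriv ::
  "('v \<Rightarrow> ('v, 'a::comm_ring_1) letter_poly) \<Rightarrow> ('v \<Rightarrow>\<^sub>0 nat) \<Rightarrow> ('v, 'a) letter_poly"
  where "monom_deriv G m = (\<Sum>v\<in>Poly_Mapping.keys m.
    Poly_Mapping.single (m - Poly_Mapping.single v 1) (of_nat (Poly_Mapping.lookup m v)) * G v)"

definition poly_deriv ::
  "('v \<Rightarrow> ('v, 'a::comm_ring_1) letter_poly) \<Rightarrow> ('v, 'a) letter_poly \<Rightarrow> ('v, 'a) letter_poly"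
  where "poly_deriv G p = (\<Sum>m\<in>Poly_Mapping.keys p.
    Scalar (Poly_Mapping.lookup p m) * monom_deriv G m)"

lemma monom_deriv_superset:
  assumes "finite A" "Poly_Mapping.keys m \<subseteq> A"
  shows "monom_deriv G m = (\<Sum>v\<in>A.
    Poly_Mapping.single (m - Poly_Mapping.single v 1) (of_nat (Poly_Mapping.lookup m v)) * G v)"
  unfolding monom_deriv_def using assms
  by (intro sum.mono_neutral_left) (auto simp: in_keys_iff)

lemma diff_single_add:
  fixes m m' :: "'v \<Rightarrow>\<^sub>0 nat"
  assumes "Poly_Mapping.lookup m v \<noteq> 0"
  shows "m' + m - Poly_Mapping.single v 1 = m' + (m - Poly_Mapping.single v 1)"
  using assms
  by (intro poly_mapping_eqI) (auto simp: lookup_add lookup_minus lookup_single when_def)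

lemma single_diff_mult:
  fixes m m' :: "'v \<Rightarrow>\<^sub>0 nat"
  shows "Poly_Mapping.single m' (1::'a::comm_ring_1) *
      Poly_Mapping.single (m - Poly_Mapping.single v 1) (of_nat (Poly_Mapping.lookup m v)) =
    Poly_Mapping.single (m' + m - Poly_Mapping.single v 1) (of_nat (Poly_Mapping.lookup m v))"
  by (cases "Poly_Mapping.lookup m v = 0") (simp_all add: mult_single diff_single_add[unfolded One_nat_def])

lemma monom_deriv_add:
  "monom_deriv G (m + m') =
    monom_deriv G m * Poly_Mapping.single m' 1 + Poly_Mapping.single m 1 * monom_deriv G m'"
proof -
  let ?A = "Poly_Mapping.keys m \<union> Poly_Mapping.keys m'"
  let ?s = "\<lambda>k m v. Poly_Mapping.single (k - Poly_Mapping.single v 1)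
    (of_nat (Poly_Mapping.lookup m v))"
  have "monom_deriv G (m + m') = (\<Sum>v\<in>?A. ?s (m + m') (m + m') v * G v)"
    by (rule monom_deriv_superset) (auto simp: in_keys_iff lookup_add)
  also have "\<dots> = (\<Sum>v\<in>?A. ?s (m' + m) m v * G v) + (\<Sum>v\<in>?A. ?s (m + m') m' v * G v)"
    by (simp add: lookup_add single_add distrib_right sum.distrib add.commute[of m'])
  also have "(\<Sum>v\<in>?A. ?s (m' + m) m v * G v) = Poly_Mapping.single m' 1 * monom_deriv G m"
    by (subst monom_deriv_superset[of ?A])
      (simp_all only: finite_UnI finite_keys Un_upper1 sum_distrib_left mult.assoc[symmetric]
        single_diff_mult)
  also have "(\<Sum>v\<in>?A. ?s (m + m') m' v * G v) = Poly_Mapping.single m 1 * monom_deriv G m'"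
    by (subst monom_deriv_superset[of ?A])
      (simp_all only: finite_UnI finite_keys Un_upper2 sum_distrib_left mult.assoc[symmetric]
        single_diff_mult)
  finally show ?thesis by (simp add: mult.commute)
qed

lemma poly_deriv_zero: "poly_deriv G 0 = 0"
  by (simp add: poly_deriv_def)

lemma poly_deriv_add: "poly_deriv G (p + q) = poly_deriv G p + poly_deriv G q"
  unfolding poly_deriv_def
  by (rule setsum_keys_plus_distrib) (simp_all add: Scalar_def single_add distrib_right)

lemma poly_deriv_single: "poly_deriv G (Poly_Mapping.single m c) = Scalar c * monom_deriv G m"
  by (cases "c = 0") (simp_all add: poly_deriv_def Scalar_def)

lemma single_eq_Scalar:
  "Poly_Mapping.single m c = Scalar c * Poly_Mapping.single m (1::'a::comm_ring_1)"
  by (simp add: Scalar_def mult_single)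

lemma Scalar_mult: "Scalar (c * d) = Scalar c * Scalar d"
  by (simp add: Scalar_def mult_single)

lemma poly_deriv_mult_single:
  "poly_deriv G (Poly_Mapping.single m c * q) =
    poly_deriv G (Poly_Mapping.single m c) * q + Poly_Mapping.single m c * poly_deriv G q"
proof (induction q rule: letter_poly_induct)
  case 1
  show ?case by (simp add: poly_deriv_zero)
next
  case (2 m' d q)
  have "poly_deriv G (Poly_Mapping.single m c * Poly_Mapping.single m' d) =
    poly_deriv G (Poly_Mapping.single m c) * Poly_Mapping.single m' d
      + Poly_Mapping.single m c * poly_deriv G (Poly_Mapping.single m' d)"
    unfolding mult_single poly_deriv_single monom_deriv_add Scalar_mult
    by (subst single_eq_Scalar[of m c], subst single_eq_Scalar[of m' d])
      (simp add: algebra_simps)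
  with 2 show ?case by (simp add: poly_deriv_add algebra_simps)
qed

lemma poly_deriv_mult: "poly_deriv G (p * q) = poly_deriv G p * q + p * poly_deriv G q"
  by (induction p rule: letter_poly_induct)
    (simp_all add: poly_deriv_zero poly_deriv_add poly_deriv_mult_single distrib_right
      distrib_left add_ac)

lemma is_formal_derivative_poly_deriv: "is_formal_derivative G (poly_deriv G)"
proof -
  have "poly_deriv G (Scalar c) = 0" for c
    by (simp add: Scalar_def poly_deriv_single monom_deriv_def)
  moreover have "poly_deriv G (Letter a) = G a" for a
    by (simp add: Letter_def poly_deriv_single monom_deriv_def Scalar_def)
  ultimately show ?thesis
    by (simp add: is_formal_derivative_def poly_deriv_add poly_deriv_mult)
qed

lemma is_formal_derivative_unique:
  fixes G :: "'v \<Rightarrow> ('v, 'a::comm_ring_1) letter_poly"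
  assumes D: "is_formal_derivative G D" and E: "is_formal_derivative G E"
  shows "D = E"
proof
  fix p
  have one: "F 1 = 0" if "is_formal_derivative G F" for F
  proof -
    have "F (1 * 1) = F 1 * 1 + 1 * F 1"
      using that unfolding is_formal_derivative_def by blast
    then show ?thesis by simp
  qed
  have zero: "F 0 = 0" if "is_formal_derivative G F" for F
  proof -
    have "F (0 + 0) = F 0 + F 0"
      using that unfolding is_formal_derivative_def by blast
    then show ?thesis by simp
  qed
  have monom: "D (Poly_Mapping.single m 1) = E (Poly_Mapping.single m 1)" for m
  proof (induction "\<Sum>v\<in>Poly_Mapping.keys m. Poly_Mapping.lookup m v" arbitrary: m)
    case 0
    then have "m = 0" by (auto intro!: poly_mapping_eqI simp: in_keys_iff)
    then show ?case using one[OF D] one[OF E] by simp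
  next
    case (Suc k)
    then obtain a where a: "a \<in> Poly_Mapping.keys m"
      by (metis Zero_not_Suc ex_in_conv sum.empty)
    define m' where "m' = m - Poly_Mapping.single a 1"
    have m: "m = Poly_Mapping.single a 1 + m'"
      using a unfolding m'_def
      by (intro poly_mapping_eqI)
        (auto simp: lookup_add lookup_minus lookup_single in_keys_iff when_def)
    have "(\<Sum>v\<in>Poly_Mapping.keys m. Poly_Mapping.lookup m v) =
        (\<Sum>v\<in>Poly_Mapping.keys (Poly_Mapping.single a (1::nat)).
          Poly_Mapping.lookup (Poly_Mapping.single a (1::nat)) v) +
        (\<Sum>v\<in>Poly_Mapping.keys m'. Poly_Mapping.lookup m' v)"
      unfolding m by (rule setsum_keys_plus_distrib[where f = "\<lambda>_ x. x"]) simp_all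
    with Suc(2) have "k = (\<Sum>v\<in>Poly_Mapping.keys m'. Poly_Mapping.lookup m' v)"
      by simp
    with Suc(1) have IH: "D (Poly_Mapping.single m' 1) = E (Poly_Mapping.single m' 1)"
      by blast
    have split: "Poly_Mapping.single m 1 = Letter a * Poly_Mapping.single m' (1::'a)"
      by (simp add: Letter_def mult_single m)
    show ?case
      using D E IH unfolding split is_formal_derivative_def by metis
  qed
  have single: "D (Poly_Mapping.single m c) = E (Poly_Mapping.single m c)" for m c
    using D E monom[of m] unfolding single_eq_Scalar[of m c] is_formal_derivative_def by metis
  show "D p = E p"
  proof (induction p rule: letter_poly_induct)
    case 1
    show ?case using zero[OF D] zero[OF E] by simp
  next
    case (2 m c q)
    then show ?case using D E single unfolding is_formal_derivative_def by metis
  qed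
qed

theorem ex1_formal_derivative: "\<exists>!D. is_formal_derivative G D"
  using is_formal_derivative_poly_deriv is_formal_derivative_unique by blast

theorem is_formal_derivative_formal_derivative: "is_formal_derivative G (formal_derivative G)"
  unfolding formal_derivative_def by (rule theI'[OF ex1_formal_derivative])

end

theory Submission
  imports Defs "HOL-Combinatorics.Multiset_Permutations"
begin

text \<open>
  Give a permutation of \<open>{1..n}\<close> with \<open>k\<close> exterior peaks the weight \<open>x\<^sup>2\<^sup>k\<^sup>+\<^sup>1y\<^sup>n\<^sup>-\<^sup>2\<^sup>k\<close>. Inserting
  \<open>n + 1\<close> next to one of the \<open>k\<close> peaks (\<open>2k\<close> ways, since peaks are never adjacent) or at the end
  keeps \<open>k\<close>; each of the other \<open>n - 2k\<close> gaps produces a new peak. These are exactly the terms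
  of \<open>D\<close> applied to the weight: \<open>x \<rightarrow> xy\<close> acts on one of \<open>2k + 1\<close> letters \<open>x\<close>, \<open>y \<rightarrow> x\<^sup>2\<close> on one of
  \<open>n - 2k\<close> letters \<open>y\<close>. Hence \<open>D\<close> maps the sum of weights over \<open>{1..n}\<close> to that over \<open>{1..n + 1}\<close>.
\<close>

section \<open>Peaks of a word and the effect of inserting a new maximum\<close>

fun peaks :: "'a::linorder list \<Rightarrow> nat" where
  "peaks (a # b # c # xs) = (if a < b \<and> c < b then 1 else 0) + peaks (b # c # xs)"
| "peaks _ = 0"

lemma peaks_descent: "b < a \<Longrightarrow> peaks (a # b # xs) = peaks (b # xs)"
  by (cases xs) auto

text \<open>Pair each peak with the letter after it: peaks are never adjacent, so the pairs are
  disjoint, and none contains the first letter.\<close>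

lemma peaks_le_length: "2 * peaks (a # xs) \<le> length xs"
proof (induction xs arbitrary: a rule: induct_list012)
  case (3 b c xs)
  show ?case
  proof (cases "a < b \<and> c < b")
    case True
    then show ?thesis using 3(1)[of c] by (simp add: peaks_descent)
  next
    case False
    then show ?thesis using 3(2)[of b] by auto
  qed
qed simp_all

lemma peaks_eq_card:
  "peaks xs = card {i. i + 2 < length xs \<and> xs ! i < xs ! (i + 1) \<and> xs ! (i + 2) < xs ! (i + 1)}"
proof (induction xs rule: peaks.induct)
  case (1 a b c xs)
  let ?P = "\<lambda>xs i. i + 2 < length xs \<and> xs ! i < xs ! (i + 1) \<and> xs ! (i + 2) < xs ! (i + 1)"
  let ?ys = "b # c # xs"
  have fin: "finite {i. ?P ?ys i}"
    by (rule finite_subset[of _ "{..length ?ys}"]) auto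
  have "{i. ?P (a # ?ys) i} = (if a < b \<and> c < b then {0} else {}) \<union> Suc ` {i. ?P ?ys i}"
    (is "?L = ?R")
  proof (rule set_eqI)
    show "i \<in> ?L \<longleftrightarrow> i \<in> ?R" for i
      by (cases i) auto
  qed
  then have "card {i. ?P (a # ?ys) i} = (if a < b \<and> c < b then 1 else 0) + card {i. ?P ?ys i}"
    using fin by (auto simp: card_insert_if card_image)
  then show ?case using 1 by simp
qed auto

definition insert_at :: "nat \<Rightarrow> 'a \<Rightarrow> 'a list \<Rightarrow> 'a list" where
  "insert_at i m xs = take i xs @ m # drop i xs"

lemma insert_at_simps [simp]:
  "insert_at 0 m xs = m # xs"
  "insert_at (Suc i) m (x # xs) = x # insert_at i m xs"
  by (simp_all add: insert_at_def)

text \<open>The fixed first letter \<open>a\<close> will be the prepended \<open>0\<close>. The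
  function \<open>f\<close> is arbitrary because splitting off a leading peak calls the induction
  hypothesis with \<open>f \<circ> Suc\<close>.\<close>

lemma sum_peaks_insert_at:
  fixes f :: "nat \<Rightarrow> 'b::comm_semiring_1"
  assumes "\<forall>x\<in>set (a # xs). x < m"
  shows "(\<Sum>i\<le>length xs. f (peaks (a # insert_at i m xs))) =
    of_nat (2 * peaks (a # xs) + 1) * f (peaks (a # xs)) +
    of_nat (length xs - 2 * peaks (a # xs)) * f (Suc (peaks (a # xs)))"
  using assms
proof (induction xs arbitrary: a f rule: induct_list012)
  case 1
  then show ?case by simp
next
  case (2 b)
  then have "\<not> m < b" by auto
  with 2 show ?case by (simp add: add.commute)
next
  case (3 b c xs)
  have "\<not> m < b" using 3(3) by auto
  show ?case
  proof (cases "a < b \<and> c < b")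
    case True
    let ?k = "peaks (c # xs)"
    \<comment> \<open>Directly before or after the peak \<open>b\<close>, the letter
      \<open>m\<close> takes over its role and the count stays. Farther right, \<open>b\<close>
      remains a peak and contributes the \<open>Suc\<close>.\<close>
    have "(\<Sum>i\<le>length (b # c # xs). f (peaks (a # insert_at i m (b # c # xs)))) =
      f (Suc ?k) + f (Suc ?k) + (\<Sum>i\<le>length xs. (f \<circ> Suc) (peaks (c # insert_at i m xs)))"
      using True 3(3) \<open>\<not> m < b\<close>
      by (simp add: sum.atMost_Suc_shift peaks_descent add.assoc
          del: sum.atMost_Suc)
    also have "(\<Sum>i\<le>length xs. (f \<circ> Suc) (peaks (c # insert_at i m xs))) =
      of_nat (2 * ?k + 1) * f (Suc ?k) + of_nat (length xs - 2 * ?k) * f (Suc (Suc ?k))"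
      using 3(3) by (subst 3(1)) auto
    finally show ?thesis
      using True by (simp add: peaks_descent algebra_simps)
  next
    case False
    let ?k = "peaks (b # c # xs)"
    have k: "peaks (a # b # c # xs) = ?k" using False by auto
    \<comment> \<open>Between \<open>a\<close> and \<open>b\<close>, \<open>m\<close> is an
      additional peak. In every later gap \<open>b\<close> remains a non-peak, since its right
      neighbour is still \<open>c\<close> or the larger \<open>m\<close>.\<close>
    have "(\<Sum>i\<le>length (b # c # xs). f (peaks (a # insert_at i m (b # c # xs)))) =
      f (Suc ?k) + (\<Sum>i\<le>length (c # xs). f (peaks (b # insert_at i m (c # xs))))"
    proof -
      have "peaks (a # b # insert_at i m (c # xs)) = peaks (b # insert_at i m (c # xs))" for i
        using False 3(3) by (cases i) auto
      then show ?thesis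
        using 3(3) \<open>\<not> m < b\<close>
        by (simp add: sum.atMost_Suc_shift peaks_descent del: sum.atMost_Suc)
    qed
    also have "(\<Sum>i\<le>length (c # xs). f (peaks (b # insert_at i m (c # xs)))) =
      of_nat (2 * ?k + 1) * f ?k + of_nat (length (c # xs) - 2 * ?k) * f (Suc ?k)"
      using 3(3) by (subst 3(2)) auto
    \<comment> \<open>The length bound rules out truncation in
      \<open>length (c # xs) - 2 * ?k\<close>, so the gap before \<open>b\<close> raises this
      coefficient by exactly one.\<close>
    finally show ?thesis
      using peaks_le_length[of b "c # xs"] unfolding k
      by (simp add: Suc_diff_le algebra_simps del: peaks.simps)
  qed
qed

section \<open>Arrangements obtained by inserting one letter\<close>

lemma sum_permutations_of_set_insert:
  fixes f :: "'a list \<Rightarrow> 'b::comm_monoid_add"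
  assumes "finite A" "m \<notin> A"
  shows "(\<Sum>ys\<in>permutations_of_set (insert m A). f ys) =
    (\<Sum>xs\<in>permutations_of_set A. \<Sum>i\<le>card A. f (insert_at i m xs))"
proof -
  let ?S = "permutations_of_set A \<times> {..card A}"
  have len: "length xs = card A" if "xs \<in> permutations_of_set A" for xs
    using that by (rule length_finite_permutations_of_set)
  \<comment> \<open>The letter \<open>m\<close> occurs only once in the result: its place gives
    \<open>i\<close>, and deleting it gives \<open>xs\<close>.\<close>
  have "inj_on (\<lambda>(xs, i). insert_at i m xs) ?S"
  proof (rule inj_onI, clarify)
    fix xs i ys j
    assume xs: "xs \<in> permutations_of_set A" and ys: "ys \<in> permutations_of_set A"
      and i: "i \<le> card A" and j: "j \<le> card A"
      and eq: "insert_at i m xs = insert_at j m ys"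
    have "m \<notin> set xs" "m \<notin> set ys"
      using assms xs ys by (auto simp: permutations_of_set_def)
    then have "m \<notin> set (take i xs)" "m \<notin> set (drop i xs)" "m \<notin> set (take j ys)"
      by (auto dest: in_set_takeD in_set_dropD)
    then have *: "take i xs = take j ys \<and> drop i xs = drop j ys"
      using eq unfolding insert_at_def by (metis append_Cons_eq_iff)
    then have "i = j"
      using i j len[OF xs] len[OF ys] by (metis length_take min.absorb2)
    then show "xs = ys \<and> i = j" using * by (metis append_take_drop_id)
  qed
  moreover have "(\<lambda>(xs, i). insert_at i m xs) ` ?S = permutations_of_set (insert m A)"
  proof (intro equalityI subsetI)
    fix ys assume "ys \<in> (\<lambda>(xs, i). insert_at i m xs) ` ?S"
    then obtain xs i where xs: "xs \<in> permutations_of_set A" and ys: "ys = insert_at i m xs"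
      by auto
    have "set xs = set (take i xs) \<union> set (drop i xs)"
      by (metis append_take_drop_id set_append)
    then show "ys \<in> permutations_of_set (insert m A)"
      using xs assms unfolding ys insert_at_def permutations_of_set_def
      by (auto simp: set_take_disj_set_drop_if_distinct)
  next
    fix ys assume ys: "ys \<in> permutations_of_set (insert m A)"
    then obtain us vs where uv: "ys = us @ m # vs"
      by (metis insertI1 in_set_conv_decomp permutations_of_setD(1))
    have xs: "us @ vs \<in> permutations_of_set A"
      using ys assms unfolding uv permutations_of_set_def by auto
    have "length us \<le> card A" using len[OF xs] by simp
    then show "ys \<in> (\<lambda>(xs, i). insert_at i m xs) ` ?S"
      using xs by (intro image_eqI[of _ _ "(us @ vs, length us)"]) (auto simp: uv insert_at_def)
  qed
  ultimately have "(\<Sum>ys\<in>permutations_of_set (insert m A). f ys) =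
    (\<Sum>(xs, i)\<in>?S. f (insert_at i m xs))"
    using sum.reindex[of "\<lambda>(xs, i). insert_at i m xs" ?S f] by (simp add: case_prod_unfold)
  then show ?thesis by (simp add: sum.cartesian_product)
qed

section \<open>Permutations as words and their exterior peaks\<close>

lemma bij_betw_permutes_permutations_of_set:
  "bij_betw (\<lambda>p. map p [1..<Suc n]) {p. p permutes {1..n}} (permutations_of_set {1..n})"
proof -
  let ?h = "\<lambda>p. map p [1..<Suc n]"
  have inj: "inj_on ?h {p. p permutes {1..n}}"
  proof (rule inj_onI)
    fix p q assume *: "p \<in> {p. p permutes {1..n}}" "q \<in> {p. p permutes {1..n}}" "?h p = ?h q"
    show "p = q"
    proof
      show "p i = q i" for i
        using * by (cases "i \<in> {1..n}") (auto simp: permutes_not_in simp del: upt_Suc)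
    qed
  qed
  \<comment> \<open>Surjectivity by counting: the injective image lies in a set of the same finite
    size.\<close>
  moreover have "?h ` {p. p permutes {1..n}} = permutations_of_set {1..n}"
  proof (rule card_subset_eq)
    show "?h ` {p. p permutes {1..n}} \<subseteq> permutations_of_set {1..n}"
    proof clarify
      fix p assume p: "p permutes {1..n}"
      have "set [1..<Suc n] = {1..n}" by auto
      then show "?h p \<in> permutations_of_set {1..n}"
        using permutes_image[OF p] permutes_inj_on[OF p, of "{1..n}"]
        by (intro permutations_of_setI) (simp_all add: distinct_map del: upt_Suc)
    qed
    show "card (?h ` {p. p permutes {1..n}}) = card (permutations_of_set {1..n})"
      using card_permutations[of "{1..n}" n] inj by (simp add: card_image)
  qed simp
  ultimately show ?thesis by (simp add: bij_betw_def)
qed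

text \<open>A permutation of \<open>{1..n}\<close> fixes \<open>0\<close>, so prepending \<open>p 0\<close> turns a descent at the first
  position into an ordinary peak.\<close>

lemma card_exterior_peaks:
  assumes "p permutes {1..n}"
  shows "card {i. exterior_peak n p i} = peaks (0 # map p [1..<Suc n])"
proof -
  have p0: "p 0 = 0" using assms by (simp add: permutes_not_in)
  have "[0..<Suc n] = 0 # [1..<Suc n]" by (simp add: upt_conv_Cons del: upt_Suc)
  then have eq: "0 # map p [1..<Suc n] = map p [0..<Suc n]" using p0 by simp
  have pos: "0 < p 1" if "1 \<le> n"
    using permutes_in_image[OF assms, of 1] that by auto
  \<comment> \<open>On the right, \<open>i\<close> is the left neighbour of the peak, hence the
    shift by \<open>Suc\<close>. For a peak at position 1 this neighbour is \<open>p 0 = 0\<close>,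
    and the ascent to \<open>p 1\<close> is automatic.\<close>
  have "{i. exterior_peak n p i} =
    Suc ` {i. i + 2 < Suc n \<and> p i < p (i + 1) \<and> p (i + 2) < p (i + 1)}" (is "?L = ?R")
  proof (rule set_eqI)
    fix i
    show "i \<in> ?L \<longleftrightarrow> i \<in> ?R"
    proof (cases i)
      case 0
      then show ?thesis by (auto simp: exterior_peak_def)
    next
      case (Suc j)
      show ?thesis
        using pos p0 unfolding Suc by (cases j) (auto simp: exterior_peak_def numeral_2_eq_2)
    qed
  qed
  also have "{i. i + 2 < Suc n \<and> p i < p (i + 1) \<and> p (i + 2) < p (i + 1)} =
    {i. i + 2 < length (map p [0..<Suc n]) \<and>
      map p [0..<Suc n] ! i < map p [0..<Suc n] ! (i + 1) \<and>
      map p [0..<Suc n] ! (i + 2) < map p [0..<Suc n] ! (i + 1)}"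
    by (auto simp del: upt_Suc)
  finally show ?thesis unfolding eq peaks_eq_card by (simp only: card_image inj_Suc)
qed

lemma T_eq_card_permutations_of_set:
  "T n k = card {xs \<in> permutations_of_set {1..n}. peaks (0 # xs) = k}"
proof -
  have "bij_betw (\<lambda>p. map p [1..<Suc n])
    {p \<in> {p. p permutes {1..n}}. card {i. exterior_peak n p i} = k}
    {xs \<in> permutations_of_set {1..n}. peaks (0 # xs) = k}"
    using bij_betw_permutes_permutations_of_set
    by (rule bij_betw_Collect) (simp add: card_exterior_peaks del: upt_Suc)
  then show ?thesis unfolding T_def by (simp add: bij_betw_same_card)
qed

text \<open>Words are grouped by their number of peaks; the length bound for \<open>0 # xs\<close>
  gives the range up to \<open>n div 2\<close>.\<close>

lemma sum_peaks_eq_sum_T: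
  fixes f :: "nat \<Rightarrow> 'b::comm_semiring_1"
  shows "(\<Sum>xs\<in>permutations_of_set {1..n}. f (peaks (0 # xs))) =
    (\<Sum>k = 0..n div 2. of_nat (T n k) * f k)"
proof -
  have "peaks (0 # xs) \<in> {0..n div 2}" if "xs \<in> permutations_of_set {1..n}" for xs
    using peaks_le_length[of 0 xs] length_finite_permutations_of_set[OF that] by simp
  then have "(\<Sum>xs\<in>permutations_of_set {1..n}. f (peaks (0 # xs))) =
    (\<Sum>k = 0..n div 2. \<Sum>xs | xs \<in> permutations_of_set {1..n} \<and> peaks (0 # xs) = k.
      f (peaks (0 # xs)))"
    by (intro sum.group[symmetric]) auto
  also have "\<dots> = (\<Sum>k = 0..n div 2. of_nat (T n k) * f k)"
    by (intro sum.cong refl) (simp add: T_eq_card_permutations_of_set)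
  finally show ?thesis .
qed

section \<open>Differentiating monomials and iterating\<close>

context
  fixes G D
  assumes D: "is_formal_derivative G D"
begin

lemma derivative_mult: "D (u * v) = D u * v + u * D v"
  using D by (simp add: is_formal_derivative_def)

lemma derivative_sum: "D (sum f A) = (\<Sum>a\<in>A. D (f a))"
proof -
  have add: "D (u + v) = D u + D v" for u v
    using D by (simp add: is_formal_derivative_def)
  from add[of 0 0] have "D 0 = 0" by simp
  with add show ?thesis by (induction A rule: infinite_finite_induct) auto
qed

lemma derivative_power: "D (u ^ k) = of_nat k * u ^ (k - 1) * D u"
proof (induction k)
  case 0
  \<comment> \<open>The Leibniz rule for \<open>1 * 1\<close> reads \<open>D 1 = D 1 + D 1\<close>,
    so \<open>D 1 = 0\<close>.\<close>
  from derivative_mult[of 1 1] show ?case by simp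
next
  case (Suc k)
  then show ?case by (cases k) (simp_all add: derivative_mult algebra_simps)
qed

end

text \<open>Writing the exponent of \<open>Letter X\<close> as \<open>a + 1\<close> avoids
  subtraction there; for \<open>b = 0\<close> the truncated \<open>b - 1\<close> is harmless, as its
  coefficient vanishes.\<close>

lemma derivative_monomial:
  assumes "is_formal_derivative grammar D"
  shows "D (Letter X ^ (a + 1) * Letter Y ^ b) =
    of_nat (a + 1) * (Letter X ^ (a + 1) * Letter Y ^ (b + 1)) +
    of_nat b * (Letter X ^ (a + 3) * Letter Y ^ (b - 1))"
proof -
  have "D (Letter X) = Letter X * Letter Y" "D (Letter Y) = Letter X ^ 2"
    using assms by (simp_all add: is_formal_derivative_def)
  then show ?thesis
    unfolding derivative_mult[OF assms] derivative_power[OF assms]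
    by (simp add: power2_eq_square numeral_3_eq_3 algebra_simps)
qed

lemma funpow_derivative_X:
  assumes "is_formal_derivative grammar D"
  shows "(D ^^ n) (Letter X) = (\<Sum>xs\<in>permutations_of_set {1..n}.
    Letter X ^ (2 * peaks (0 # xs) + 1) * Letter Y ^ (n - 2 * peaks (0 # xs)))"
proof (induction n)
  case 0
  show ?case by simp
next
  case (Suc n)
  let ?w = "\<lambda>n k. Letter X ^ (2 * k + 1) * Letter Y ^ (n - 2 * k)"
  have "(D ^^ Suc n) (Letter X) =
    (\<Sum>xs\<in>permutations_of_set {1..n}. D (?w n (peaks (0 # xs))))"
    by (simp add: Suc derivative_sum[OF assms])
  also have "\<dots> = (\<Sum>xs\<in>permutations_of_set {1..n}. \<Sum>i\<le>card {1..n}.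
    ?w (Suc n) (peaks (0 # insert_at i (Suc n) xs)))"
  proof (rule sum.cong[OF refl])
    fix xs assume xs: "xs \<in> permutations_of_set {1..n}"
    let ?k = "peaks (0 # xs)"
    have len: "length xs = n" using length_finite_permutations_of_set[OF xs] by simp
    have k: "2 * ?k \<le> n" using peaks_le_length[of 0 xs] len by simp
    \<comment> \<open>Take \<open>a = 2 * ?k\<close> and \<open>b = n - 2 * ?k\<close>: then
      \<open>a + 3\<close> is \<open>2 * Suc ?k + 1\<close>, and \<open>b - 1\<close> is
      \<open>Suc n - 2 * Suc ?k\<close>.\<close>
    have "D (?w n ?k) =
      of_nat (2 * ?k + 1) * ?w (Suc n) ?k + of_nat (n - 2 * ?k) * ?w (Suc n) (Suc ?k)"
      unfolding derivative_monomial[OF assms] using k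
      by (simp add: Suc_diff_le numeral_3_eq_3 mult.assoc)
    \<comment> \<open>Inserting after the leading \<open>0\<close> reaches all \<open>n + 1\<close>
      gaps of \<open>xs\<close>, and \<open>Suc n\<close> exceeds every letter of
      \<open>0 # xs\<close>.\<close>
    also have "\<dots> = (\<Sum>i\<le>length xs. ?w (Suc n) (peaks (0 # insert_at i (Suc n) xs)))"
      using xs len
      by (subst sum_peaks_insert_at) (auto dest: permutations_of_setD(1))
    finally show "D (?w n ?k) =
      (\<Sum>i\<le>card {1..n}. ?w (Suc n) (peaks (0 # insert_at i (Suc n) xs)))"
      by (simp add: len)
  qed
  also have "\<dots> = (\<Sum>xs\<in>permutations_of_set (insert (Suc n) {1..n}).
    ?w (Suc n) (peaks (0 # xs)))"
    by (rule sum_permutations_of_set_insert[symmetric]) auto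
  also have "insert (Suc n) {1..n} = {1..Suc n}" by auto
  finally show ?case .
qed

theorem theorem4p1:
  fixes n :: nat
  assumes "n \<ge> 1"
  shows "(formal_derivative grammar ^^ n) (Letter X :: (letter, 'a::comm_ring_1) letter_poly) =
    (\<Sum>k = 0..n div 2. of_nat (T n k) * Letter X ^ (2 * k + 1) * Letter Y ^ (n - 2 * k))"
  unfolding funpow_derivative_X[OF is_formal_derivative_formal_derivative]
  using sum_peaks_eq_sum_T[where f = "\<lambda>k. Letter X ^ (2 * k + 1) * Letter Y ^ (n - 2 * k)"]
  by (simp add: mult.assoc)

end
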